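(* Suppose that $q\equiv\pm1\pmod{12}$, and let $s\in\{\sqrt3/2,-\sqrt3/2\}\subset\mathbb{F}_q$, so that $c=1-s^2=1/4\in\mathcal{C}$. Then each monic irreducible factor $I(y)$ of $g_s(y)$ over $\mathbb{F}_q$ has the form $$y^6-3y^5+\frac{27}{8}y^4-\frac74y^3+\frac{105}{256}y^2-\frac{9}{256}y-m$$ for some $m\in\mathbb{F}_q$.
   Context: $\mathbb{F}_q$ is a finite field with $q$ elements, $q$ a power of an odd prime; $n=(q+1)/2$; for $s\in\mathbb{F}_q$, $g_s(y) := y^n+(1-y)^n-s \in \mathbb{F}_q[y]$. $\rho$ is the quadratic character on $\mathbb{F}_q$ and $\mathcal{C} := \{a \in \mathbb{F}_q : \rho(a)=\rho(1-a)=1\}$. (For $q\equiv\pm1\pmod{12}$, $3$ is a square in $\mathbb{F}_q$.) *)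

theory Defs
  imports
    "HOL-Computational_Algebra.Computational_Algebra"
    "HOL-Number_Theory.Cong"
    "HOL-Library.Cardinality"
begin

definition quad_char :: "'a::{field,finite} \<Rightarrow> int" where
  "quad_char a = (if a = 0 then 0 else if \<exists>b. a = b ^ 2 then 1 else - 1)"

definition set_C :: "'a::{field,finite} set" where
  "set_C = {a. quad_char a = 1 \<and> quad_char (1 - a) = 1}"

text \<open>The field with q elements is a type of class \<open>{field,finite}\<close>, so q is \<open>CARD('a)\<close>.
  The polynomial \<open>[:1, -1:]\<close> is \<open>1 - y\<close>.\<close>

definition g_poly :: "'a::{field,finite} \<Rightarrow> 'a poly" where
  "g_poly s = (let n = (CARD('a) + 1) div 2 in monom 1 n + [:1, - 1:] ^ n - [:s:])"

end

theory Submission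
  imports "HOL-Number_Theory.Residues" "HOL-Algebra.Algebraic_Closure_Type" Defs
begin

text \<open>
  Let \<open>F\<close> be a finite field with \<open>q\<close> elements, and let \<open>y\<close> be a root of \<open>g\<^sub>s\<close> in the algebraic
  closure of \<open>F\<close>, with conjugate \<open>z = y\<^sup>q\<close>. As \<open>2n = q + 1\<close>, the numbers \<open>u = y\<^sup>n\<close> and
  \<open>v = (1 - y)\<^sup>n\<close> satisfy \<open>u\<^sup>2 = yz\<close>, \<open>v\<^sup>2 = (1 - y)(1 - z)\<close> and \<open>u + v = s\<close>. Eliminating \<open>u\<close> and \<open>v\<close>
  puts \<open>(y, z)\<close> on a symmetric conic. In the coordinates \<open>x = 2y - 1\<close> and \<open>x' = 2z - 1\<close>, and with
  \<open>s\<^sup>2 = 3/4\<close>, this conic is \<open>x\<^sup>2 - xx' + x'\<^sup>2 = 3/4\<close> (lemma \<open>conic_of_square_roots\<close>). It is the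
  relation between \<open>cos t\<close> and \<open>cos (t + \<pi>/3)\<close>, and this explains what follows: the Frobenius map
  acts on \<open>x\<close> like a rotation of order six.

  Indeed \<open>x\<close> and the second conjugate \<open>x''\<close> of \<open>x\<close> are both roots of the quadratic polynomial that the
  conic attaches to \<open>x'\<close>. If they differ, they are all its roots, so \<open>x'' = x' - x\<close>, and the orbit of
  \<open>x\<close> is \<open>x, x', x'', -x, -x', -x''\<close>, with six distinct entries (lemma \<open>card_frob_orbit\<close>). The square
  of the Chebyshev polynomial \<open>4x\<^sup>3 - 3x\<close> of \<open>cos 3t\<close> takes the same value at the two coordinates
  of a point of the conic, so its value at \<open>x\<close> is fixed by Frobenius and hence lies in \<open>F\<close>.
  Written in \<open>y\<close>, and up to an affine change of its values, this square is the sextic of the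
  theorem. So for some \<open>m\<close> in \<open>F\<close> the sextic has the
  six conjugates of \<open>y\<close> as its roots. The minimal polynomial of \<open>y\<close> has them too, and the two coincide.

  The degenerate case \<open>x'' = x\<close>, that is, a root of \<open>g\<^sub>s\<close> in the quadratic extension of \<open>F\<close>, does not
  occur (lemma \<open>not_frob2_fixed\<close>). In that case \<open>u\<close> and \<open>v\<close> lie in \<open>F\<close>, which forces
  the square roots \<open>t\<close> of \<open>y\<close> and \<open>r\<close> of \<open>1 - y\<close> to lie in the quadratic extension as well. The trace
  \<open>t + t\<^sup>q\<close> is in \<open>F\<close>, the difference \<open>r - r\<^sup>q\<close> is negated by Frobenius, but since \<open>1 - s\<^sup>2 = 1/4\<close> is
  a square their product is in \<open>F\<close>. So the product vanishes, which amounts to \<open>u - v = -1\<close> (lemma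
  \<open>conjugate_sqrt_difference\<close>). By symmetry \<open>v - u = -1\<close>, and the sum of the two is \<open>0 = -2\<close>.

  Finally, \<open>3\<close> is a square because \<open>\<zeta> + \<zeta>\<^sup>-\<^sup>1\<close> is a square root of it when \<open>\<zeta>\<close> is a primitive twelfth root
  of unity, and \<open>q \<equiv> \<plusminus>1\<close> modulo \<open>12\<close> says that Frobenius fixes or exchanges the two summands.
\<close>

(* These names are kept for the notions of the type classes, not for those of a monoid record. *)
hide_const (open) Divisibility.irreducible Divisibility.prime

section \<open>The Frobenius map on the algebraic closure of a finite field\<close>

text \<open>Multiplication by a nonzero \<open>x\<close> permutes the nonzero elements, so their product absorbs the
  factor \<open>x\<^sup>q\<^sup>-\<^sup>1\<close>.\<close>

lemma finite_field_power_card: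
  fixes x :: "'a::{field,finite}"
  shows "x ^ CARD('a) = x"
proof (cases "x = 0")
  case False
  have "(\<Prod>y\<in>UNIV-{0}. x * y) = (\<Prod>y\<in>UNIV-{0}. y)"
    by (rule prod.reindex_bij_witness[of _ "\<lambda>y. y / x" "\<lambda>y. x * y"]) (use False in auto)
  hence "x ^ (CARD('a) - 1) * \<Prod>(UNIV-{0}) = \<Prod>(UNIV-{0::'a})"
    by (simp add: prod.distrib)
  hence "x ^ (CARD('a) - 1) = 1"
    by simp
  moreover have "x ^ CARD('a) = x * x ^ (CARD('a) - 1)"
    by (metis finite_UNIV_card_ge_0 finite power_eq_if less_numeral_extra(3))
  ultimately show ?thesis by simp
qed (auto simp: finite_UNIV_card_ge_0)

definition frob :: "'a::{field,finite} alg_closure \<Rightarrow> 'a alg_closure" where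
  "frob x = x ^ CARD('a)"

lemma frob_mult [simp]: "frob (x * y) = frob x * frob y"
  by (simp add: frob_def power_mult_distrib)

lemma frob_power [simp]: "frob (x ^ k) = frob x ^ k"
  by (simp add: frob_def mult.commute flip: power_mult)

lemma frob_to_ac [simp]: "frob (to_ac a) = to_ac a"
  by (simp add: frob_def finite_field_power_card flip: to_ac_power)

lemma frob_0 [simp]: "frob 0 = 0"
  using frob_to_ac[of 0] by simp

lemma frob_1 [simp]: "frob 1 = 1"
  using frob_to_ac[of 1] by simp

lemma frob_numeral [simp]: "frob (numeral k) = numeral k"
  using frob_to_ac[of "numeral k"] by simp

lemma frob_divide [simp]: "frob (x / y) = frob x / frob y"
  by (simp add: frob_def power_divide)

lemma card_range_to_ac: "card (range (to_ac :: 'a::{field,finite} \<Rightarrow> _)) = CARD('a)"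
  by (simp add: card_image inj_to_ac)

text \<open>The elements of the base field are the roots of \<open>X\<^sup>q - X\<close>. Both the description of the fixed
  field of Frobenius and the additivity of Frobenius are derived from this factorisation.\<close>

lemma prod_diff_to_ac:
  fixes x :: "'a::{field,finite} alg_closure"
  shows "(\<Prod>a\<in>UNIV. x - to_ac (a::'a)) = frob x - x"
proof -
  have q: "CARD('a) > 1"
    using card_UNIV_unit by (metis UNIV_I card_1_singletonE finite finite_UNIV_card_ge_0 less_one
      linorder_neqE_nat not_less_zero singletonD zero_neq_one)
  let ?L = "\<Prod>a\<in>UNIV. [:- to_ac (a::'a), 1:]"
  have deg: "degree ?L = CARD('a)"
    by (subst degree_prod_eq_sum_degree) auto
  have lc: "lead_coeff ?L = 1"
    by (simp add: lead_coeff_prod)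
  have "?L = monom 1 CARD('a) - [:0, 1:]"
  proof (rule poly_eqI_degree_lead_coeff[where n = "CARD('a)" and A = "range (to_ac :: 'a \<Rightarrow> _)"])
    show "poly.coeff ?L CARD('a) = poly.coeff (monom 1 CARD('a) - [:0, 1:]) CARD('a)"
      using lc q deg by (simp add: coeff_pCons split: nat.splits)
    show "degree (monom 1 CARD('a) - [:0, 1 :: 'a alg_closure:]) \<le> CARD('a)"
      using q by (intro degree_diff_le) (auto simp: degree_monom_le)
  next
    fix z :: "'a alg_closure"
    assume "z \<in> range to_ac"
    then obtain a where z: "z = to_ac a" by auto
    hence "poly ?L z = 0" by (auto simp: poly_prod)
    thus "poly ?L z = poly (monom 1 CARD('a) - [:0, 1:]) z"
      by (simp add: z poly_monom flip: frob_def)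
  qed (auto simp: deg card_range_to_ac)
  hence "poly ?L x = poly (monom 1 CARD('a) - [:0, 1:]) x" by simp
  thus ?thesis by (simp add: poly_prod poly_monom frob_def)
qed

lemma frob_fixed_imp_to_ac:
  fixes x :: "'a::{field,finite} alg_closure"
  assumes "frob x = x"
  obtains a :: 'a where "x = to_ac a"
proof -
  have "(\<Prod>a\<in>UNIV. x - to_ac (a::'a)) = 0"
    using assms by (simp add: prod_diff_to_ac)
  thus ?thesis using that by auto
qed

text \<open>Translating \<open>x\<close> by an element of the base field only permutes the factors of the product above.\<close>

lemma frob_add_to_ac:
  fixes x :: "'a::{field,finite} alg_closure"
  shows "frob (to_ac a + x) = to_ac a + frob x"
proof -
  have "(\<Prod>b\<in>UNIV. to_ac a + x - to_ac b) = (\<Prod>b\<in>UNIV. x - to_ac (b::'a))"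
    by (rule prod.reindex_bij_witness[of _ "\<lambda>b. b + a" "\<lambda>b. b - a"]) auto
  thus ?thesis unfolding prod_diff_to_ac by (simp add: algebra_simps)
qed

text \<open>For a fixed \<open>y\<close>, the polynomials \<open>(X + y)\<^sup>q\<close> and \<open>X\<^sup>q + y\<^sup>q\<close> are both monic of degree \<open>q\<close> and agree
  at the \<open>q\<close> elements of the base field, hence they are equal.\<close>

lemma frob_add [simp]:
  fixes x y :: "'a::{field,finite} alg_closure"
  shows "frob (x + y) = frob x + frob y"
proof -
  have "[:y, 1:] ^ CARD('a) = monom 1 CARD('a) + [:frob y:]"
  proof (rule poly_eqI_degree_lead_coeff[where n = "CARD('a)" and A = "range (to_ac :: 'a \<Rightarrow> _)"])
    have deg: "degree ([:y, 1:] ^ CARD('a)) = CARD('a)"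
      by (simp add: degree_power_eq)
    have "lead_coeff ([:y, 1:] ^ CARD('a)) = 1"
      by (simp add: lead_coeff_power)
    hence "poly.coeff ([:y, 1:] ^ CARD('a)) CARD('a) = 1"
      using deg by (simp only:)
    with deg show "poly.coeff ([:y, 1:] ^ CARD('a)) CARD('a) = poly.coeff (monom 1 CARD('a) + [:frob y:]) CARD('a)"
         "degree ([:y, 1:] ^ CARD('a)) \<le> CARD('a)"
      by (auto simp: coeff_pCons split: nat.splits)
    show "degree (monom 1 CARD('a) + [:frob y:]) \<le> CARD('a)"
      by (intro degree_add_le) (auto simp: degree_monom_le)
  next
    fix z :: "'a alg_closure"
    assume "z \<in> range to_ac"
    then obtain a where z: "z = to_ac a" by auto
    show "poly ([:y, 1:] ^ CARD('a)) z = poly (monom 1 CARD('a) + [:frob y:]) z"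
      using frob_add_to_ac[of a y] frob_to_ac[of a]
      by (simp add: z poly_monom add.commute frob_def poly_power)
  qed (auto simp: card_range_to_ac)
  hence "poly ([:y, 1:] ^ CARD('a)) x = poly (monom 1 CARD('a) + [:frob y:]) x" by simp
  thus ?thesis by (simp add: poly_monom poly_power frob_def add.commute)
qed

lemma frob_diff [simp]: "frob (x - y) = frob x - frob y"
  using frob_add[of "x - y" y] by (simp del: frob_add add: algebra_simps)

lemma frob_uminus [simp]: "frob (- x) = - frob x"
  using frob_diff[of 0 x] by (simp del: frob_diff)

lemma frob_eq_0_iff [simp]: "frob x = 0 \<longleftrightarrow> x = 0"
  by (auto simp: frob_def)

lemma frob_eq_iff [simp]: "frob x = frob y \<longleftrightarrow> x = y"
  using frob_eq_0_iff[of "x - y"] by simp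

section \<open>Polynomials over the base field and their roots in the closure\<close>

definition eval_ac :: "'a::field poly \<Rightarrow> 'a alg_closure \<Rightarrow> 'a alg_closure" where
  "eval_ac p x = poly (map_poly to_ac p) x"

lemma eval_ac_0 [simp]: "eval_ac 0 x = 0"
  by (simp add: eval_ac_def)

lemma eval_ac_pCons [simp]: "eval_ac (pCons a p) x = to_ac a + x * eval_ac p x"
  by (simp add: eval_ac_def map_poly_pCons)

lemma eval_ac_add [simp]: "eval_ac (p + q) x = eval_ac p x + eval_ac q x"
  by (induction p q rule: poly_induct2) (simp_all add: algebra_simps)

lemma eval_ac_smult [simp]: "eval_ac (Polynomial.smult c p) x = to_ac c * eval_ac p x"
  by (induction p) (simp_all add: algebra_simps)

lemma eval_ac_mult [simp]: "eval_ac (p * q) x = eval_ac p x * eval_ac q x"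
  by (induction p) (simp_all add: algebra_simps)

lemma eval_ac_power [simp]: "eval_ac (p ^ k) x = eval_ac p x ^ k"
  by (induction k) (simp_all add: one_pCons)

lemma eval_ac_monom [simp]: "eval_ac (monom c k) x = to_ac c * x ^ k"
  by (simp add: eval_ac_def map_poly_monom poly_monom)

lemma eval_ac_diff [simp]: "eval_ac (p - q) x = eval_ac p x - eval_ac q x"
  using eval_ac_add[of "p - q" q x] by (simp del: eval_ac_add add: algebra_simps)

lemma eval_ac_frob: "eval_ac p (frob x) = frob (eval_ac p x)"
  by (induction p) simp_all

lemma irreducible_eval_ac_root:
  fixes p :: "'a::field poly"
  assumes "irreducible p"
  obtains x where "eval_ac p x = 0"
proof -
  have "degree p > 0"
    using assms is_unit_iff_degree[of p] by (auto simp: Factorial_Ring.irreducible_def)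
  hence "degree (map_poly to_ac p) > 0"
    by (subst degree_map_poly) auto
  thus ?thesis using alg_closed_imp_poly_has_root that unfolding eval_ac_def by blast
qed

text \<open>The polynomial \<open>d\<close> has \<open>degree d\<close> distinct roots, all of them roots of \<open>p\<close> as well. The remainder of
  \<open>p\<close> modulo \<open>d\<close> vanishes at them and has a smaller degree, so it is zero.\<close>

lemma monic_irreducible_eqI:
  fixes p d :: "'a::field poly"
  assumes "irreducible p" "lead_coeff p = 1" "lead_coeff d = 1" "degree d > 0"
    and roots: "\<And>x. x \<in> A \<Longrightarrow> eval_ac d x = 0" "\<And>x. x \<in> A \<Longrightarrow> eval_ac p x = 0"
    and card: "card A = degree d"
  shows "p = d"
proof -
  define r where "r = p mod d"
  have "eval_ac r x = 0" if "x \<in> A" for x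
  proof -
    have "eval_ac (p div d * d + r) x = 0"
      using roots(2)[OF that] unfolding r_def by simp
    thus ?thesis using roots(1)[OF that] by simp
  qed
  moreover have "d \<noteq> 0" using assms(4) by auto
  hence "degree r < degree d"
    using degree_mod_less[of d p] assms(4) by (auto simp: r_def)
  hence "degree (map_poly to_ac r) < card A"
    using card by (subst degree_map_poly) auto
  ultimately have "map_poly to_ac r = 0"
    by (intro poly_eqI_degree[of A]) (auto simp: eval_ac_def)
  hence "r = 0"
    by (simp add: map_poly_eq_0_iff)
  hence "d dvd p" by (auto simp: r_def)
  then obtain c where c: "p = d * c" by blast
  have "\<not> d dvd 1"
    using assms(4) by (metis is_unit_iff_degree not_gr0 degree_0)
  hence "c dvd 1"
    using assms(1) c Factorial_Ring.irreducibleD by blast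
  then obtain k where "c = [:k:]" using is_unit_polyE by metis
  moreover have "lead_coeff p = lead_coeff d * lead_coeff c"
    unfolding c by (rule lead_coeff_mult)
  ultimately have "k = 1" using assms(2,3) by (simp only: lead_coeff_pCons) simp
  thus ?thesis using c \<open>c = [:k:]\<close> by simp
qed

section \<open>The correspondence between a root and its conjugate\<close>

text \<open>Squaring \<open>v = s - u\<close> makes \<open>u\<close> an affine function of \<open>y + z\<close>; squaring once more removes \<open>u\<close>. The
  affine relation serves to see that \<open>u\<close> is fixed by every field automorphism that
  fixes \<open>s\<close> and exchanges \<open>y\<close> and \<open>z\<close>, if \<open>2\<close> and \<open>s\<close> are nonzero.\<close>

lemma conic_of_square_roots:
  fixes y z u v s :: "'b::field"
  assumes u: "u ^ 2 = y * z" and v: "v ^ 2 = (1 - y) * (1 - z)"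
    and s: "u + v = s" "4 * s ^ 2 = 3"
  shows "8 * (s * u) = 4 * (y + z) - 1"
    and "4 * ((2*y-1) ^ 2 + (2*z-1) ^ 2 - (2*y-1) * (2*z-1)) = 3"
proof -
  have "v = s - u" using s(1) by (simp add: algebra_simps)
  hence "(s - u) ^ 2 = (1 - y) * (1 - z)" using v by simp
  hence "s^2 - 2 * (s * u) + u^2 = 1 - y - z + y * z"
    by (simp add: power2_eq_square algebra_simps)
  hence "2 * (s * u) = s^2 - 1 + y + z" using u by (simp add: algebra_simps)
  hence "4 * (2 * (s * u)) = 4 * (s^2 - 1 + y + z)" by simp
  also have "\<dots> = 4 * s^2 - 4 + 4 * (y + z)" by (simp add: algebra_simps)
  finally show *: "8 * (s * u) = 4 * (y + z) - 1" using s(2) by simp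
  have "(8 * (s * u)) ^ 2 = 16 * ((4 * s ^ 2) * u ^ 2)"
    by (simp add: power2_eq_square algebra_simps)
  hence "48 * (y * z) = (4 * (y + z) - 1) ^ 2" unfolding * u s by simp
  moreover have "4 * ((2*y-1) ^ 2 + (2*z-1) ^ 2 - (2*y-1) * (2*z-1)) - 3
      = (4 * (y + z) - 1) ^ 2 - 48 * (y * z)"
    by (simp add: power2_eq_square algebra_simps)
  ultimately show "4 * ((2*y-1) ^ 2 + (2*z-1) ^ 2 - (2*y-1) * (2*z-1)) = 3"
    by simp
qed

text \<open>In the quadratic extension, \<open>A = t + t\<^sup>q\<close> is a trace and \<open>B = r - r\<^sup>q\<close> has trace zero. With
  \<open>e\<close> for the left-hand side of the conclusion, \<open>A\<^sup>2 = (1 + s) e\<close> and \<open>B\<^sup>2 = (1 - s) e\<close>,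
  and \<open>4 (1 - s\<^sup>2) = 1\<close>. So \<open>2 A B\<close> is \<open>e\<close> or \<open>-e\<close>, which is fixed by Frobenius although \<open>A B\<close> is negated.\<close>

lemma conjugate_sqrt_difference:
  fixes t r :: "'a::{field,finite} alg_closure" and s :: 'a
  assumes two: "(2 :: 'a alg_closure) \<noteq> 0" and s: "4 * s ^ 2 = 3"
    and t: "frob (frob t) = t" and r: "frob (frob r) = r"
    and tr: "t ^ 2 + r ^ 2 = 1" "t * frob t + r * frob r = to_ac s"
  shows "1 + t * frob t - r * frob r = 0"
proof -
  define A where "A = t + frob t"
  define B where "B = r - frob r"
  define e where "e = 1 + t * frob t - r * frob r"
  have s': "4 * to_ac s ^ 2 = 3"
    using s by (metis to_ac_mult to_ac_numeral to_ac_power)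
  have "frob t ^ 2 + frob r ^ 2 = 1"
    using arg_cong[OF tr(1), of frob] by simp
  hence sq: "r ^ 2 = 1 - t ^ 2" "frob r ^ 2 = 1 - frob t ^ 2"
    using tr(1) by (auto simp: algebra_simps)
  have "(1 + to_ac s) * e = (1 + t * frob t) ^ 2 - r ^ 2 * frob r ^ 2"
    unfolding e_def tr(2)[symmetric] by (simp add: power2_eq_square algebra_simps)
  also have "\<dots> = A ^ 2"
    unfolding sq A_def by (simp add: power2_eq_square algebra_simps)
  finally have A2: "A ^ 2 = (1 + to_ac s) * e" ..
  have sq': "t ^ 2 = 1 - r ^ 2" "frob t ^ 2 = 1 - frob r ^ 2"
    using sq by simp_all
  have "(1 - to_ac s) * e = (1 - r * frob r) ^ 2 - t ^ 2 * frob t ^ 2"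
    unfolding e_def tr(2)[symmetric] by (simp add: power2_eq_square algebra_simps)
  also have "\<dots> = B ^ 2"
    unfolding sq' B_def by (simp add: power2_eq_square algebra_simps)
  finally have B2: "B ^ 2 = (1 - to_ac s) * e" ..
  have "(2 * A * B) ^ 2 = (4 - 4 * to_ac s ^ 2) * e ^ 2"
    unfolding power_mult_distrib A2 B2 by (simp add: power2_eq_square algebra_simps)
  hence "(2 * A * B) ^ 2 = e ^ 2" using s' by simp
  hence "2 * A * B = e \<or> 2 * A * B = - e" by (simp add: power2_eq_iff)
  moreover have "frob e = e" "frob A = A" "frob B = - B"
    by (simp_all add: e_def A_def B_def t r algebra_simps)
  \<comment> \<open>Frobenius fixes the right-hand sides and changes the sign of the left-hand sides.\<close>
  ultimately have "2 * A * B = - (2 * A * B)"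
    by (metis frob_mult frob_numeral frob_uminus minus_equation_iff mult_minus_right)
  hence "2 * A * B = 0"
    using two by (metis add.right_inverse mult_2 mult_eq_0_iff)
  thus ?thesis using \<open>2 * A * B = e \<or> 2 * A * B = - e\<close> unfolding e_def[symmetric] by auto
qed

text \<open>Applying Frobenius to \<open>t\<^sup>q = u / t\<close>, where \<open>u = t\<^sup>q\<^sup>+\<^sup>1\<close> is in the base field, leads back to \<open>t\<close>.\<close>

lemma frob2_sqrt:
  fixes t :: "'a::{field,finite} alg_closure"
  assumes "frob (t * frob t) = t * frob t"
  shows "frob (frob t) = t"
proof (cases "t = 0")
  case False
  thus ?thesis using assms by (simp add: mult.commute)
qed auto

text \<open>The conic relation shows that \<open>u = y\<^sup>n\<close> is fixed by Frobenius, so \<open>t\<close> and \<open>r\<close> lie in the quadratic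
  extension. The preceding identity then holds for \<open>(t, r)\<close> and for \<open>(r, t)\<close>, and the
  sum of the two is \<open>2 = 0\<close>.\<close>

lemma not_frob2_fixed:
  fixes y :: "'a::{field,finite} alg_closure" and s :: 'a
  assumes odd: "odd CARD('a)" and two: "(2 :: 'a alg_closure) \<noteq> 0"
    and three: "(3 :: 'a alg_closure) \<noteq> 0" and s: "4 * s ^ 2 = 3"
    and root: "y ^ ((CARD('a) + 1) div 2) + (1 - y) ^ ((CARD('a) + 1) div 2) = to_ac s"
  shows "frob (frob y) \<noteq> y"
proof
  assume fix2: "frob (frob y) = y"
  have s': "4 * to_ac s ^ 2 = 3"
    using s by (metis to_ac_mult to_ac_numeral to_ac_power)
  obtain t where t: "t ^ 2 = y" using nth_root_exists[of 2 y] by auto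
  obtain r where r: "r ^ 2 = 1 - y" using nth_root_exists[of 2 "1 - y"] by auto
  have half: "(x ^ 2) ^ ((CARD('a) + 1) div 2) = x * frob x" for x :: "'a alg_closure"
  proof -
    have "2 * ((CARD('a) + 1) div 2) = Suc CARD('a)" using odd by simp
    thus ?thesis unfolding power_mult[symmetric] frob_def by (simp only: power_Suc)
  qed
  have sum: "t * frob t + r * frob r = to_ac s"
    using root half[of t] half[of r] by (simp add: t r)
  have "frob t ^ 2 = frob y" "frob r ^ 2 = 1 - frob y"
    using arg_cong[OF t, of frob] arg_cong[OF r, of frob] by simp_all
  hence "(t * frob t) ^ 2 = y * frob y" "(r * frob r) ^ 2 = (1 - y) * (1 - frob y)"
    by (simp_all add: power_mult_distrib t r)
  hence lin: "8 * (to_ac s * (t * frob t)) = 4 * (y + frob y) - 1"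
    using conic_of_square_roots(1) sum s' by blast
  have "8 * (to_ac s * frob (t * frob t)) = frob (8 * (to_ac s * (t * frob t)))"
    by simp
  also have "\<dots> = 4 * (y + frob y) - 1"
    unfolding lin by (simp add: fix2)
  finally have "8 * (to_ac s * frob (t * frob t)) = 8 * (to_ac s * (t * frob t))"
    unfolding lin .
  moreover have "8 * to_ac s \<noteq> 0"
    using s' three power_not_zero[OF two, of 3] by auto
  ultimately have u: "frob (t * frob t) = t * frob t"
    by (metis mult.assoc mult_left_cancel)
  have "r * frob r = to_ac s - t * frob t" using sum by (simp add: algebra_simps)
  hence v: "frob (r * frob r) = r * frob r" using u by simp
  have t2: "frob (frob t) = t" by (rule frob2_sqrt[OF u])
  have r2: "frob (frob r) = r" by (rule frob2_sqrt[OF v])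
  have "1 + t * frob t - r * frob r = 0"
    using two s t2 r2 t r sum by (intro conjugate_sqrt_difference) auto
  moreover have "1 + r * frob r - t * frob t = 0"
    using two s t2 r2 t r sum by (intro conjugate_sqrt_difference) (auto simp: add.commute)
  ultimately have "(1 + t * frob t - r * frob r) + (1 + r * frob r - t * frob t) = 0"
    by simp
  thus False using two by simp
qed

section \<open>The orbit of a root\<close>

text \<open>The square of the Chebyshev polynomial \<open>T\<^sub>3\<close>, for which \<open>T\<^sub>3 (cos t) = cos 3t\<close>.\<close>

definition orbit_invariant :: "'b::field \<Rightarrow> 'b" where
  "orbit_invariant x = (x * (4 * x ^ 2 - 3)) ^ 2"

text \<open>If \<open>x = cos t\<close> and \<open>x' = cos (t + \<pi>/3)\<close>, then \<open>T\<^sub>3 x' = cos (3t + \<pi>) = - T\<^sub>3 x\<close>. The algebraic form of this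
  is that the conic relation divides \<open>T\<^sub>3 x + T\<^sub>3 x'\<close>.\<close>

lemma orbit_invariant_conjugate:
  fixes x x' :: "'b::field"
  assumes "4 * (x ^ 2 + x' ^ 2 - x * x') = 3"
  shows "orbit_invariant x' = orbit_invariant x"
proof -
  have "x' * (4 * x' ^ 2 - 3) + x * (4 * x ^ 2 - 3)
      = (x + x') * (4 * (x ^ 2 + x' ^ 2 - x * x') - 3)"
    by (simp add: power2_eq_square algebra_simps)
  hence "x' * (4 * x' ^ 2 - 3) = - (x * (4 * x ^ 2 - 3))"
    unfolding assms by (simp add: eq_neg_iff_add_eq_0)
  thus ?thesis by (simp add: orbit_invariant_def)
qed

text \<open>The conic is symmetric, so \<open>x\<close> and \<open>frob (frob x)\<close> solve the same quadratic equation, the sum of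
  whose roots is \<open>frob x\<close>.\<close>

lemma frob2_eq_diff:
  fixes x :: "'a::{field,finite} alg_closure"
  assumes two: "(2 :: 'a alg_closure) \<noteq> 0"
    and conic: "4 * (x ^ 2 + frob x ^ 2 - x * frob x) = 3"
    and fix2: "frob (frob x) \<noteq> x"
  shows "frob (frob x) = frob x - x"
proof -
  define x1 where "x1 = frob x"
  define x2 where "x2 = frob x1"
  have conic': "4 * (x1 ^ 2 + x2 ^ 2 - x1 * x2) = 3"
    using arg_cong[OF conic, of frob] by (simp add: x1_def x2_def)
  have "4 * ((x2 - x) * (x2 + x - x1))
      = 4 * (x1 ^ 2 + x2 ^ 2 - x1 * x2) - 4 * (x ^ 2 + x1 ^ 2 - x * x1)"
    by (simp add: power2_eq_square algebra_simps)
  hence "4 * ((x2 - x) * (x2 + x - x1)) = 0"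
    using conic unfolding conic' x1_def[symmetric] by simp
  moreover have "(4 :: 'a alg_closure) \<noteq> 0"
    using two by (metis mult_2 mult_eq_0_iff numeral_Bit0)
  ultimately have "x2 + x - x1 = 0"
    using fix2 unfolding x1_def x2_def by (metis mult_eq_0_iff right_minus_eq)
  thus ?thesis by (simp add: x1_def x2_def algebra_simps)
qed

text \<open>Every coincidence among the six conjugates would, after applying a power of Frobenius, make
  \<open>x\<close> zero or fixed by the square of Frobenius.\<close>

lemma card_frob_orbit:
  fixes x :: "'a::{field,finite} alg_closure"
  assumes two: "(2 :: 'a alg_closure) \<noteq> 0"
    and x2: "frob (frob x) = frob x - x" and fix2: "frob (frob x) \<noteq> x"
  shows "card {x, frob x, frob (frob x), - x, - frob x, - frob (frob x)} = 6"
proof -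
  define x1 where "x1 = frob x"
  define x2 where "x2 = frob x1"
  have nz: "x \<noteq> 0" "x1 \<noteq> 0" "x2 \<noteq> 0"
    using fix2 by (auto simp: x1_def x2_def)
  have neg: "a \<noteq> - a" if "a \<noteq> 0" for a :: "'a alg_closure"
    using that two by (metis add.right_inverse mult_2 mult_eq_0_iff)
  have a: "x1 \<noteq> x" "x2 \<noteq> x" "x2 \<noteq> x1"
    using fix2 unfolding x1_def x2_def by auto
  have b: "x1 \<noteq> - x"
    using fix2 by (auto simp: x1_def)
  hence c: "x2 \<noteq> - x1"
    using frob_eq_iff[of x1 "- x"] unfolding x2_def x1_def by (simp del: frob_eq_iff)
  have d: "x2 \<noteq> - x"
    using nz x2 unfolding x1_def x2_def by auto
  have "card {x, x1, x2, - x, - x1, - x2} = 6"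
    using nz neg[of x] neg[of x1] neg[of x2] a b c d
    by (auto simp: card_insert_if minus_equation_iff equation_minus_iff)
  thus ?thesis by (simp add: x1_def x2_def)
qed

definition sextic :: "'b::field \<Rightarrow> 'b poly" where
  "sextic m = [:- m, - (9 / 256), 105 / 256, - (7 / 4), 27 / 8, - 3, 1:]"

lemma degree_sextic: "degree (sextic m) = 6" "lead_coeff (sextic m) = 1"
  by (simp_all add: sextic_def)

text \<open>The sextic is \<open>T\<^sub>3 (2y - 1)\<^sup>2\<close>, made monic by the factor \<open>1/1024\<close> and freed of its constant term.\<close>

lemma sextic_eval:
  fixes y :: "'a::field alg_closure"
  assumes "(2 :: 'a alg_closure) \<noteq> 0"
  shows "1024 * eval_ac (sextic m) y = orbit_invariant (2 * y - 1) - 1 - 1024 * to_ac m"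
proof -
  have nz: "(4::'a alg_closure) \<noteq> 0" "(8::'a alg_closure) \<noteq> 0" "(256::'a alg_closure) \<noteq> 0"
    using power_not_zero[OF assms, of 2] power_not_zero[OF assms, of 3] power_not_zero[OF assms, of 8]
    by simp_all
  have coeffs: "1024 * - (9 / 256) = (- 36 :: 'a alg_closure)" "1024 * (105 / 256) = (420 :: 'a alg_closure)"
    "1024 * - (7 / 4) = (- 1792 :: 'a alg_closure)" "1024 * (27 / 8) = (3456 :: 'a alg_closure)"
    using nz by (simp_all add: field_simps)
  have "1024 * (a + y * (b + y * (c + y * (d + y * (e + y * (f + y * 1))))))
      = 1024 * a + (1024 * b) * y + (1024 * c) * y^2 + (1024 * d) * y^3 + (1024 * e) * y^4
        + 1024 * f * y^5 + 1024 * y^6" for a b c d e f :: "'a alg_closure"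
    by (simp add: algebra_simps power2_eq_square power_numeral_even power_numeral_odd)
  \<comment> \<open>The expansion is used for general coefficients, so that no fraction is ever split up.\<close>
  from this[of "- to_ac m" "- (9 / 256)" "105 / 256" "- (7 / 4)" "27 / 8" "- 3"]
  have "1024 * eval_ac (sextic m) y
      = - 1024 * to_ac m - 36 * y + 420 * y^2 - 1792 * y^3 + 3456 * y^4 - 3072 * y^5 + 1024 * y^6"
    unfolding coeffs by (simp add: sextic_def)
  also have "\<dots> = orbit_invariant (2 * y - 1) - 1 - 1024 * to_ac m"
    unfolding orbit_invariant_def
    by (simp add: algebra_simps power2_eq_square power_numeral_even power_numeral_odd)
  finally show ?thesis .
qed

text \<open>A factor \<open>p\<close> has a root \<open>y\<close> in the closure, and then all its conjugates. The constant \<open>m\<close> is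
  chosen to make the sextic vanish at \<open>y\<close>; it lies in the base field because the orbit
  invariant takes the same value at \<open>x\<close> and at \<open>frob x\<close>.\<close>

lemma irreducible_factor_eq_sextic:
  fixes p :: "'a::{field,finite} poly" and s :: 'a
  assumes odd: "odd CARD('a)" and two: "(2 :: 'a) \<noteq> 0" and three: "(3 :: 'a) \<noteq> 0"
    and s: "4 * s ^ 2 = 3"
    and p: "irreducible p" "lead_coeff p = 1" "p dvd g_poly s"
  shows "\<exists>m. p = sextic m"
proof -
  have two': "(2 :: 'a alg_closure) \<noteq> 0" and three': "(3 :: 'a alg_closure) \<noteq> 0"
    using two three by (metis to_ac_eq_0_iff to_ac_numeral)+
  have s': "4 * to_ac s ^ 2 = 3"
    using s by (metis to_ac_mult to_ac_numeral to_ac_power)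
  define n where "n = (CARD('a) + 1) div 2"
  have n: "2 * n = Suc CARD('a)" using odd by (simp add: n_def)
  obtain y where y: "eval_ac p y = 0" using irreducible_eval_ac_root[OF p(1)] .
  have "eval_ac (g_poly s) y = 0" using p(3) y by (auto elim!: dvdE)
  hence root: "y ^ n + (1 - y) ^ n = to_ac s"
    by (simp add: g_poly_def Let_def n_def)
  have norm: "(x ^ n) ^ 2 = x * frob x" for x :: "'a alg_closure"
    by (simp add: frob_def mult.commute[of n] n flip: power_mult)
  define x where "x = 2 * y - 1"
  have conic: "4 * (x ^ 2 + frob x ^ 2 - x * frob x) = 3"
    using conic_of_square_roots(2)[OF norm _ root s'] norm[of "1 - y"] root
    by (simp add: x_def)
  have y_eq: "y = (1 + x) / 2" using two' by (simp add: x_def)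
  have fix2: "frob (frob x) \<noteq> x"
    using not_frob2_fixed[OF odd two' three' s] root two' unfolding n_def by (simp add: x_def)
  have x2: "frob (frob x) = frob x - x" by (rule frob2_eq_diff[OF two' conic fix2])
  define c where "c = (orbit_invariant x - 1) / 1024"
  have k: "(1024 :: 'a alg_closure) \<noteq> 0" using power_not_zero[OF two', of 10] by simp
  have inv: "orbit_invariant (frob x) = orbit_invariant x"
    using conic by (rule orbit_invariant_conjugate)
  have "frob (orbit_invariant x) = orbit_invariant (frob x)"
    by (simp add: orbit_invariant_def)
  hence "frob c = c" by (simp add: c_def inv)
  then obtain m where m: "c = to_ac m" by (rule frob_fixed_imp_to_ac)
  define W where "W = {x, frob x, frob (frob x), - x, - frob x, - frob (frob x)}"
  define A where "A = (\<lambda>x. (1 + x) / 2) ` W"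
  have inv2: "orbit_invariant (frob (frob x)) = orbit_invariant x"
    using arg_cong[OF inv, of frob] inv by (simp add: orbit_invariant_def)
  have "orbit_invariant z = orbit_invariant x" if "z \<in> W" for z
    using that inv inv2 by (auto simp: W_def orbit_invariant_def)
  hence "eval_ac (sextic m) z = 0" if "z \<in> A" for z
    using that sextic_eval[OF two', of m z] two' k
    by (auto simp: A_def m[symmetric] c_def)
  moreover have "eval_ac p z = 0" if "z \<in> A" for z
  proof -
    define P where "P = (\<lambda>a. eval_ac p ((1 + a) / 2) = 0)"
    have step: "P (frob a)" if "P a" for a
      using that eval_ac_frob[of p "(1 + a) / 2"] by (simp add: P_def)
    have "P x" using y y_eq by (simp add: P_def)
    moreover have "frob (frob (frob x)) = - x"
      using x2 arg_cong[OF x2, of frob] by simp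
    ultimately have "P a" if "a \<in> W" for a
      using that step unfolding W_def by (metis empty_iff frob_uminus insert_iff)
    thus ?thesis using that by (auto simp: A_def P_def)
  qed
  moreover have "card A = 6"
    unfolding A_def using card_frob_orbit[OF two' x2 fix2] two'
    by (subst card_image) (auto simp: inj_on_def W_def)
  ultimately have "p = sextic m"
    using p(1,2) degree_sextic[of m]
    by (intro monic_irreducible_eqI[where p = p and d = "sextic m" and A = A]) (simp only: | simp)+
  thus ?thesis ..
qed

section \<open>The square root of three\<close>

lemma prime_of_nat_nonzero:
  assumes "prime p" "\<not> p dvd CARD('a::{field,finite})"
  shows "(of_nat p :: 'a) \<noteq> 0"
proof
  assume "(of_nat p :: 'a) = 0"
  hence "CHAR('a) dvd p" by (simp add: of_nat_eq_0_iff_char_dvd)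
  hence "CHAR('a) = p" using assms(1) by (metis CHAR_not_1 One_nat_def prime_nat_iff)
  thus False using assms(2) CHAR_dvd_CARD[where 'a = 'a] by simp
qed

text \<open>The roots of \<open>X\<^sup>4 - X\<^sup>2 + 1\<close> are primitive twelfth roots of unity. As \<open>z\<^sup>1\<^sup>1 = z\<^sup>-\<^sup>1\<close>, Frobenius either fixes
  \<open>z\<close> and \<open>z\<^sup>1\<^sup>1\<close> or exchanges them.\<close>

lemma sqrt3_exists:
  assumes "CARD('a::{field,finite}) mod 12 \<in> {1, 11}"
  shows "\<exists>r::'a. r ^ 2 = 3"
proof -
  obtain z :: "'a alg_closure" where "poly [:1, 0, - 1, 0, 1:] z = 0"
    using alg_closed_imp_poly_has_root[of "[:1, 0, - 1, 0, 1 :: 'a alg_closure:]"] by auto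
  hence z4: "z ^ 4 = z ^ 2 - 1"
    by (simp add: algebra_simps eval_nat_numeral)
  have z6: "z ^ 6 = - 1"
  proof -
    have "z ^ 6 = z ^ 2 * z ^ 4" by (simp flip: power_add)
    also have "\<dots> = z ^ 4 - z ^ 2" by (simp add: z4 algebra_simps flip: power_add)
    finally show ?thesis by (simp add: z4)
  qed
  have z12: "z ^ 12 = 1"
    using arg_cong[OF z6, of "\<lambda>x. x ^ 2"] by (simp flip: power_mult)
  have red: "z ^ k = z ^ (k mod 12)" for k
  proof -
    have "z ^ k = z ^ (12 * (k div 12) + k mod 12)" by simp
    also have "\<dots> = z ^ (k mod 12)" unfolding power_add power_mult z12 by simp
    finally show ?thesis .
  qed
  define r where "r = z + z ^ 11"
  have fz: "frob z = z ^ (CARD('a) mod 12)" unfolding frob_def by (rule red)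
  have "z ^ 121 = z" using red[of 121] by simp
  hence "frob r = r"
    using assms fz by (auto simp: r_def simp flip: power_mult)
  then obtain a where a: "r = to_ac a" by (rule frob_fixed_imp_to_ac)
  have "r ^ 2 = z ^ 2 + 2 * z ^ 12 + z ^ 22"
    unfolding r_def by (simp add: power2_sum flip: power_mult power_Suc)
  also have "z ^ 22 = z ^ 6 * z ^ 4" using red[of 22] by (simp flip: power_add)
  also have "z ^ 2 + 2 * z ^ 12 + z ^ 6 * z ^ 4 = 3" by (simp add: z12 z6 z4)
  finally have "to_ac (a ^ 2) = to_ac (3 :: 'a)" by (simp add: a)
  thus ?thesis by (auto simp only: to_ac_eq_iff)
qed

lemma quad_char_square: "b \<noteq> 0 \<Longrightarrow> quad_char (b ^ 2) = 1"
  by (auto simp: quad_char_def)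

theorem corollary4p9:
  assumes odd_q: "odd CARD('a::{field,finite})"
    and q_mod_12: "[int CARD('a) = 1] (mod 12) \<or> [int CARD('a) = - 1] (mod 12)"
  shows "(\<exists>r::'a. r ^ 2 = 3) \<and>
    (\<forall>r s::'a. r ^ 2 = 3 \<longrightarrow> s \<in> {r / 2, - (r / 2)} \<longrightarrow>
       1 - s ^ 2 = 1 / 4 \<and> 1 / 4 \<in> (set_C :: 'a set) \<and>
       (\<forall>I. lead_coeff I = 1 \<longrightarrow> irreducible I \<longrightarrow> I dvd g_poly s \<longrightarrow>
          (\<exists>m. I = [:- m, - (9 / 256), 105 / 256, - (7 / 4), 27 / 8, - 3, 1:])))"
proof (intro conjI allI impI)
  have "int (CARD('a) mod 12) = 1 \<or> int (CARD('a) mod 12) = 11"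
    using q_mod_12 by (auto simp: cong_def zmod_int)
  hence mod12: "CARD('a) mod 12 \<in> {1, 11}" by auto
  thus "\<exists>r::'a. r ^ 2 = 3" by (rule sqrt3_exists)
  have two: "(2 :: 'a) \<noteq> 0"
    using prime_of_nat_nonzero[of 2, where 'a = 'a] odd_q by simp
  have "\<not> 3 dvd CARD('a) mod 12" using mod12 by auto
  hence "\<not> 3 dvd CARD('a)" by (simp add: dvd_mod_iff)
  hence three: "(3 :: 'a) \<noteq> 0"
    using prime_of_nat_nonzero[of 3, where 'a = 'a] by simp
  have four: "(4 :: 'a) \<noteq> 0"
    using power_not_zero[OF two, of 2] by simp
  fix r s :: 'a
  assume r: "r ^ 2 = 3" and "s \<in> {r / 2, - (r / 2)}"
  hence "s ^ 2 = (r / 2) ^ 2"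
    by (elim insertE emptyE) (simp_all only: power2_minus)
  hence s2: "s ^ 2 = 3 / 4" by (simp add: power_divide r)
  thus "1 - s ^ 2 = 1 / 4" using four by (simp add: field_simps)
  have "s \<noteq> 0" using s2 three four by auto
  hence "quad_char (1 - 1 / 4 :: 'a) = 1"
    using quad_char_square[of s] s2 four by (simp add: field_simps)
  moreover have "quad_char (1 / 4 :: 'a) = 1"
    using quad_char_square[of "1 / 2 :: 'a"] two by (simp add: power_divide)
  ultimately show "1 / 4 \<in> (set_C :: 'a set)" by (simp add: set_C_def)
  fix I :: "'a poly"
  assume I: "lead_coeff I = 1" "irreducible I" "I dvd g_poly s"
  have "4 * s ^ 2 = 3" using s2 four by (simp add: mult.commute)
  from irreducible_factor_eq_sextic[OF odd_q two three this I(2,1,3)]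
  show "\<exists>m. I = [:- m, - (9 / 256), 105 / 256, - (7 / 4), 27 / 8, - 3, 1:]"
    by (simp add: sextic_def)
qed

end
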